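(* In the open online TSP on the line under the LOCATIONS+FINAL prediction model, the algorithm PIVOT is $\min\{f(\eta,\delta),3\}$-competitive, where $f(\eta,\delta)=1+\frac{1+2(\delta+3\eta)}{3-2(\delta+2\eta)}$ if $3-2(\delta+2\eta)>0$ and $f(\eta,\delta)=3$ if $3-2(\delta+2\eta)\le 0$.
   Context: Online TSP on the line: an agent starts at the origin at time $0$ and moves on the real line with speed at most $1$. There is a set $Q=\{q_1,\dots,q_n\}$ of requests, each with a position (also denoted $q_i$) and a release time $rel(q_i)$; the algorithm knows $n$ in advance and learns a request only at its release time. A request $q$ is served at time $t$ if the agent was at position $q$ at some time $t'$ with $rel(q)\le t'\le t$. In the open variant the makespan $|ALG|$ is the first time at which all requests are served. $|OPT|$ is the optimal offline makespan; $c$-competitive means $|ALG|\le c|OPT|$ on every instance. By convention $Q$ contains a request at the origin released at time $0$ whose prediction is exactly $0$. Let $L=\min Q$, $R=\max Q$. LOCATIONS+FINAL (LF) prediction model: at time $0$ the algorithm receives predicted positions $P=\{p_1,\dots,p_n\}$ ($p_i$ predicts $q_i$) and a label $f'$, predicting the label of a request on which an optimal offline solution finishes. Errors: $\eta=\max_i|q_i-p_i|/(|L|+|R|)$, and $\delta=|q_{f'}-q_f|/(|L|+|R|)$, where $q_f$ is, among the requests on which some optimal offline solution may finish (serve last), one minimizing the distance to $q_{f'}$. PIVOT: whenever a request is released (and at time $0$) it recomputes a plan and executes it at unit speed, waiting when the plan is exhausted. With $pos$ the current position, $O$ the set of released unserved requests, $P'$ the set of predictions whose requests are not yet released: if $P'$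 is empty, then if $pos<\frac{\max O+\min O}{2}$ move to $\min O$ then to $\max O$, else move to $\max O$ then to $\min O$. Otherwise, if $p_{f'}>\frac{\max P+\min P}{2}$, move to $\min(P'\cup O)$ then to $\min P'$; else move to $\max(P'\cup O)$ then to $\max P'$. *)

theory Defs
  imports "HOL-Analysis.Analysis"
begin

text \<open>
  Requests are labelled by a finite type \<^typ>\<open>'a\<close>: \<open>q i\<close> and \<open>rel i\<close> are the position and the
  release time of request \<open>i\<close>, \<open>p i\<close> is its predicted position. The position of the agent as a
  function of time is \<open>x\<close>; only times \<open>\<ge> 0\<close> matter.
\<close>

definition served :: "('a \<Rightarrow> real) \<Rightarrow> ('a \<Rightarrow> real) \<Rightarrow> (real \<Rightarrow> real) \<Rightarrow> 'a \<Rightarrow> real \<Rightarrow> bool" where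
  "served q rel x i t \<longleftrightarrow> (\<exists>t'. rel i \<le> t' \<and> t' \<le> t \<and> x t' = q i)"

text \<open>Completion times live in \<^typ>\<open>ereal\<close>: they are \<open>\<infinity>\<close> if the service never happens. For a
  continuous \<open>x\<close> the infima below are attained, so they are the first such times.\<close>

definition serve_time :: "('a \<Rightarrow> real) \<Rightarrow> ('a \<Rightarrow> real) \<Rightarrow> (real \<Rightarrow> real) \<Rightarrow> 'a \<Rightarrow> ereal" where
  "serve_time q rel x i = (INF t \<in> {t. served q rel x i t}. ereal t)"

definition makespan :: "('a \<Rightarrow> real) \<Rightarrow> ('a \<Rightarrow> real) \<Rightarrow> (real \<Rightarrow> real) \<Rightarrow> ereal" where
  "makespan q rel x = (INF t \<in> {t. \<forall>i. served q rel x i t}. ereal t)"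

definition trajectory :: "(real \<Rightarrow> real) \<Rightarrow> bool" where
  "trajectory x \<longleftrightarrow> x 0 = 0 \<and> 1-lipschitz_on {0..} x"

definition opt :: "('a \<Rightarrow> real) \<Rightarrow> ('a \<Rightarrow> real) \<Rightarrow> ereal" where
  "opt q rel = (INF x \<in> {x. trajectory x}. makespan q rel x)"

definition optimal :: "('a \<Rightarrow> real) \<Rightarrow> ('a \<Rightarrow> real) \<Rightarrow> (real \<Rightarrow> real) \<Rightarrow> bool" where
  "optimal q rel x \<longleftrightarrow> trajectory x \<and> makespan q rel x = opt q rel"

definition opt_finals :: "('a \<Rightarrow> real) \<Rightarrow> ('a \<Rightarrow> real) \<Rightarrow> 'a set" where
  "opt_finals q rel = {i. \<exists>x. optimal q rel x \<and> serve_time q rel x i = makespan q rel x}"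

text \<open>The errors are \<^typ>\<open>ereal\<close>s because of the normalising factor \<open>\<bar>L\<bar> + \<bar>R\<bar>\<close>, which vanishes iff
  all requests are at the origin. In \<^typ>\<open>ereal\<close>, \<open>x / 0 = \<infinity>\<close> for \<open>x > 0\<close> and \<open>0 / 0 = 0\<close>.\<close>

definition spread :: "('a::finite \<Rightarrow> real) \<Rightarrow> real" where
  "spread q = \<bar>Min (range q)\<bar> + \<bar>Max (range q)\<bar>"

definition loc_error :: "('a::finite \<Rightarrow> real) \<Rightarrow> ('a \<Rightarrow> real) \<Rightarrow> ereal" where
  "loc_error q p = ereal (Max (range (\<lambda>i. \<bar>q i - p i\<bar>))) / ereal (spread q)"

definition final_error :: "('a::finite \<Rightarrow> real) \<Rightarrow> ('a \<Rightarrow> real) \<Rightarrow> 'a \<Rightarrow> ereal" where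
  "final_error q rel f' =
     ereal (Min ((\<lambda>f. \<bar>q f' - q f\<bar>) ` opt_finals q rel)) / ereal (spread q)"

text \<open>\<open>follow y w s\<close> is the position after moving for time \<open>s\<close> at unit speed from \<open>y\<close> through the
  waypoints \<open>w\<close>, waiting at the last one.\<close>

fun follow :: "real \<Rightarrow> real list \<Rightarrow> real \<Rightarrow> real" where
  "follow y [] s = y"
| "follow y (a # w) s =
     (if s < \<bar>a - y\<bar> then y + sgn (a - y) * s else follow a w (s - \<bar>a - y\<bar>))"

definition pivot_plan ::
  "real set \<Rightarrow> real \<Rightarrow> real \<Rightarrow> real set \<Rightarrow> real set \<Rightarrow> real list" where
  "pivot_plan P pf' pos Out P' =
     (if P' = {} then
        (if Out = {} then []
         else if pos < (Max Out + Min Out) / 2 then [Min Out, Max Out]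
         else [Max Out, Min Out])
      else if pf' > (Max P + Min P) / 2 then [Min (P' \<union> Out), Min P']
      else [Max (P' \<union> Out), Max P'])"

text \<open>Replanning at time \<open>t\<close>, where \<open>x\<close> is the trajectory resulting from the plans made before:
  the motion up to time \<open>t\<close> is kept, and the rest is replaced by the new plan.\<close>

definition pivot_update ::
  "('a \<Rightarrow> real) \<Rightarrow> ('a \<Rightarrow> real) \<Rightarrow> ('a \<Rightarrow> real) \<Rightarrow> 'a \<Rightarrow> real \<Rightarrow> (real \<Rightarrow> real) \<Rightarrow> real \<Rightarrow> real" where
  "pivot_update q rel p f' t x =
     (let Out = q ` {i. rel i \<le> t \<and> \<not> served q rel x i t};
          P' = p ` {i. t < rel i};
          w = pivot_plan (range p) (p f') (x t) Out P'
      in (\<lambda>s. if s \<le> t then x s else follow (x t) w (s - t)))"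

definition pivot ::
  "('a::finite \<Rightarrow> real) \<Rightarrow> ('a \<Rightarrow> real) \<Rightarrow> ('a \<Rightarrow> real) \<Rightarrow> 'a \<Rightarrow> real \<Rightarrow> real" where
  "pivot q rel p f' =
     fold (pivot_update q rel p f') (sorted_list_of_set (insert 0 (range rel))) (\<lambda>_. 0)"

definition f_bound :: "ereal \<Rightarrow> ereal \<Rightarrow> ereal" where
  "f_bound \<eta> \<delta> =
     (if 3 - 2 * (\<delta> + 2 * \<eta>) > 0
      then 1 + (1 + 2 * (\<delta> + 3 * \<eta>)) / (3 - 2 * (\<delta> + 2 * \<eta>))
      else 3)"

end

theory Submission
  imports Defs
begin

text \<open>
  Let \<open>T\<close> be the optimum, \<open>f\<close> a request on which an optimal solution finishes, \<open>W = R - L\<close>, and \<open>e\<close>,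
  \<open>d\<close> the errors before normalisation. Suppose that PIVOT sweeps from left to right; the other case
  is the mirror image. With \<open>z = R - q f\<close>, the optimum visits \<open>L\<close> and \<open>R\<close> in some order and then
  ends in \<open>q f\<close>, so \<open>T \<ge> W + min z (W - z)\<close>.

  When PIVOT waits at a prediction \<open>p k\<close> until time \<open>rel k\<close>, the optimum still has to go from
  \<open>q k \<le> p k + e\<close> to \<open>q f\<close>, so at that time PIVOT could reach \<open>R\<close> by time \<open>T + z + e\<close>. When a
  request \<open>i\<close> turns up behind PIVOT, going back to it costs twice its distance, which is at most
  \<open>e\<close>, but \<open>T \<ge> rel i + \<bar>q i - q f\<bar>\<close> regains this loss, so nothing accumulates. Hence PIVOT finishes by
  time \<open>T + z + e\<close>. As \<open>z \<le> W / 2 + d + 2 e\<close> by the choice of the direction, the worst case is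
  \<open>T = 3 W / 2 - d - 2 e\<close>, where the excess \<open>z + e\<close> is at most \<open>W / 2 + d + 3 e\<close>.

  The bound 3 holds since PIVOT is within distance \<open>T\<close> of the origin at the last release time, which
  is at most \<open>T\<close>, and could serve everything from the origin within time \<open>T\<close>.
\<close>

section \<open>Existence of an optimal solution\<close>

text \<open>A solution reduced to its vector of service times: the bound by
  \<open>\<bar>q i\<bar>\<close> is the speed limit on the way from the origin, the pairwise bound
  the one between two requests. Minimising over trajectories thus becomes a finite-dimensional
  problem.\<close>

definition schedule :: "('a \<Rightarrow> real) \<Rightarrow> ('a \<Rightarrow> real) \<Rightarrow> ('a \<Rightarrow> real) \<Rightarrow> real \<Rightarrow> bool" where
  "schedule q rel s T \<longleftrightarrow>
     (\<forall>i. rel i \<le> s i \<and> \<bar>q i\<bar> \<le> s i \<and> s i \<le> T) \<and> (\<forall>i j. \<bar>q i - q j\<bar> \<le> \<bar>s i - s j\<bar>)"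

text \<open>The trajectory is the McShane extension of the partial map \<open>0 \<mapsto> 0\<close>, \<open>s i \<mapsto> q i\<close>.\<close>

lemma schedule_imp_trajectory:
  fixes q rel s :: "'a::finite \<Rightarrow> real"
  assumes "schedule q rel s T"
  obtains x where "trajectory x" "makespan q rel x \<le> ereal T"
proof
  \<comment> \<open>Each member is, as a function of \<open>t\<close>, a cone of slope 1 with apex
    at a prescribed point. The minimum of the cones inherits the speed limit, and the schedule
    conditions say that no cone passes below another apex.\<close>
  define A where "A t = insert \<bar>t\<bar> (range (\<lambda>i. q i + \<bar>t - s i\<bar>))" for t
  define x where "x t = Min (A t)" for t
  have fin: "finite (A t)" "A t \<noteq> {}" for t by (auto simp: A_def)
  have sched: "rel i \<le> s i" "\<bar>q i\<bar> \<le> s i" "s i \<le> T" "\<bar>q i - q j\<bar> \<le> \<bar>s i - s j\<bar>" for i j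
    using assms by (auto simp: schedule_def)
  have lip: "x t \<le> x t' + \<bar>t - t'\<bar>" for t t'
  proof -
    have "x t' \<in> A t'" unfolding x_def using fin by (rule Min_in)
    then obtain a where "a \<in> A t" "a \<le> x t' + \<bar>t - t'\<bar>"
    proof (cases "x t' = \<bar>t'\<bar>")
      case True
      then show ?thesis using that[of "\<bar>t\<bar>"] by (simp add: A_def)
    next
      case False
      then obtain i where "x t' = q i + \<bar>t' - s i\<bar>"
        using \<open>x t' \<in> A t'\<close> by (auto simp: A_def)
      then show ?thesis using that[of "q i + \<bar>t - s i\<bar>"] by (simp add: A_def)
    qed
    then show ?thesis unfolding x_def[of t] using fin by (meson Min_le order_trans)
  qed
  have "x 0 = 0"
    unfolding x_def using fin
  proof (intro Min_eqI)
    fix a assume "a \<in> A 0"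
    then show "0 \<le> a"
    proof (cases "a = 0")
      case False
      then obtain i where "a = q i + \<bar>0 - s i\<bar>" using \<open>a \<in> A 0\<close> by (auto simp: A_def)
      then show ?thesis using sched(2)[of i] by linarith
    qed simp
  qed (auto simp: A_def)
  moreover have "1-lipschitz_on {0..} x"
  proof (rule lipschitz_onI)
    fix t t' :: real
    show "dist (x t) (x t') \<le> 1 * dist t t'"
      using lip[of t t'] lip[of t' t] by (simp add: dist_real_def)
  qed simp
  ultimately show "trajectory x" by (simp add: trajectory_def)
  have "x (s i) = q i" for i
    unfolding x_def using fin(1)
  proof (rule Min_eqI)
    fix a assume a: "a \<in> A (s i)"
    show "q i \<le> a"
    proof (cases "a = \<bar>s i\<bar>")
      case True
      then show ?thesis using sched(2)[of i] by linarith
    next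
      case False
      then obtain j where "a = q j + \<bar>s i - s j\<bar>" using a by (auto simp: A_def)
      then show ?thesis using sched(4)[of i j] by linarith
    qed
  qed (auto simp: A_def intro!: image_eqI[of _ _ i])
  then have "served q rel x i T" for i
    unfolding served_def using sched by blast
  then show "makespan q rel x \<le> ereal T"
    unfolding makespan_def by (intro INF_lower) simp
qed

text \<open>By continuity the visits to \<open>q i\<close> from \<open>rel i\<close> on form a
  closed set, so there is a first one. Continuity is known only from time 0 on, whence
  \<open>0 \<le> rel i\<close>.\<close>

lemma first_service:
  assumes "trajectory x" "0 \<le> rel i" "served q rel x i t0"
  obtains s where "rel i \<le> s" "x s = q i" "\<And>t. served q rel x i t \<longleftrightarrow> s \<le> t"
    "serve_time q rel x i = ereal s"
proof -
  define S where "S = {t \<in> {rel i..}. x t = q i}"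
  have "continuous_on {0..} x"
    using assms(1) lipschitz_on_continuous_on by (auto simp: trajectory_def)
  then have "continuous_on {rel i..} x"
    by (rule continuous_on_subset) (use assms(2) in auto)
  then have "closed S"
    unfolding S_def by (intro continuous_closed_preimage_constant) auto
  moreover have "S \<noteq> {}" "bdd_below S"
    using assms(3) by (auto simp: S_def served_def intro: bdd_belowI[of _ "rel i"])
  ultimately have "Inf S \<in> S"
    by (intro closed_contains_Inf)
  moreover have "Inf S \<le> t" if "t \<in> S" for t
    using that \<open>bdd_below S\<close> by (rule cInf_lower)
  ultimately have served: "served q rel x i t \<longleftrightarrow> Inf S \<le> t" for t
    by (force simp: served_def S_def)
  have "serve_time q rel x i = ereal (Inf S)"
    unfolding serve_time_def served
    by (intro antisym INF_lower2[of "Inf S"] INF_greatest) auto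
  then show ?thesis
    using that[of "Inf S"] \<open>Inf S \<in> S\<close> served by (auto simp: S_def)
qed

lemma trajectory_imp_schedule:
  fixes q rel :: "'a::finite \<Rightarrow> real"
  assumes "trajectory x" "\<And>i. 0 \<le> rel i" "makespan q rel x \<noteq> \<infinity>"
  obtains s T where "schedule q rel s T" "\<And>i. serve_time q rel x i = ereal (s i)"
    "T \<in> range s" "makespan q rel x = ereal T"
proof -
  have "{t. \<forall>i. served q rel x i t} \<noteq> {}"
  proof
    assume "{t. \<forall>i. served q rel x i t} = {}"
    then have "makespan q rel x = \<infinity>"
      unfolding makespan_def by (simp only: image_empty Inf_empty top_ereal_def)
    with assms(3) show False by simp
  qed
  then obtain t0 where "served q rel x i t0" for i by auto
  then have "\<exists>s. rel i \<le> s \<and> x s = q i \<and> (\<forall>t. served q rel x i t \<longleftrightarrow> s \<le> t) \<and>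
      serve_time q rel x i = ereal s" for i
    using first_service[of x rel i q t0] assms by metis
  then obtain s where s: "rel i \<le> s i" "x (s i) = q i" "served q rel x i t \<longleftrightarrow> s i \<le> t"
      "serve_time q rel x i = ereal (s i)" for i t
    by metis
  define T where "T = Max (range s)"
  have T: "T \<in> range s" "s i \<le> T" for i
    by (auto simp: T_def)
  have makespan: "makespan q rel x = ereal T"
    unfolding makespan_def s using T
    by (intro antisym INF_lower2[of T] INF_greatest) auto
  have s0: "0 \<le> s i" for i
    using s(1) assms(2) order_trans by blast
  have x: "x 0 = 0" "1-lipschitz_on {0..} x"
    using assms(1) by (auto simp: trajectory_def)
  have "\<bar>q i\<bar> \<le> s i" for i
    using lipschitz_onD[OF x(2), of 0 "s i"] s0[of i] s(2)[of i] x(1) by (simp add: dist_real_def)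
  moreover have "\<bar>q i - q j\<bar> \<le> \<bar>s i - s j\<bar>" for i j
    using lipschitz_onD[OF x(2), of "s i" "s j"] s0 s(2) by (simp add: dist_real_def)
  ultimately have "schedule q rel s T"
    using s T by (simp add: schedule_def)
  then show ?thesis
    using s T makespan that by blast
qed

lemma schedule_exists:
  fixes q rel :: "'a::finite \<Rightarrow> real"
  obtains s T where "schedule q rel s T"
proof -
  obtain e :: "'a \<Rightarrow> nat" where e: "inj e"
    using finite_imp_inj_to_nat_seg[of "UNIV :: 'a set"] by auto
  define M where "M = (\<Sum>i\<in>UNIV. \<bar>q i\<bar> + \<bar>rel i\<bar>)"
  have M: "\<bar>q i\<bar> + \<bar>rel i\<bar> \<le> M" for i
    unfolding M_def by (intro member_le_sum) auto
  then have "0 \<le> M" by (meson abs_ge_zero add_nonneg_nonneg order_trans)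
  \<comment> \<open>The requests are served one by one in the order of \<open>e\<close>. The offset
    \<open>M\<close> covers all release times and the way from the origin, and a gap of
    \<open>2 * M\<close> any way between two requests.\<close>
  define s where "s i = M + real (e i) * (2 * M)" for i
  have "\<bar>q i - q j\<bar> \<le> \<bar>s i - s j\<bar>" for i j
  proof (cases "i = j")
    case False
    then have "e i \<noteq> e j"
      using injD[OF e] by blast
    then have "1 \<le> \<bar>real (e i) - real (e j)\<bar>"
      by linarith
    then have "2 * M \<le> \<bar>real (e i) - real (e j)\<bar> * (2 * M)"
      using \<open>0 \<le> M\<close> mult_right_mono by fastforce
    also have "\<dots> = \<bar>s i - s j\<bar>"
      using \<open>0 \<le> M\<close> by (simp add: s_def abs_mult flip: left_diff_distrib)
    finally show ?thesis
      using M[of i] M[of j] by linarith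
  qed simp
  moreover have "rel i \<le> s i" "\<bar>q i\<bar> \<le> s i" for i
    using M[of i] \<open>0 \<le> M\<close> mult_nonneg_nonneg[of "real (e i)" "2 * M"]
    unfolding s_def by linarith+
  ultimately have "schedule q rel s (Max (range s))"
    by (simp add: schedule_def)
  then show ?thesis by (rule that)
qed

text \<open>Schedules are cut out by non-strict inequalities between continuous functions, so they
  form a closed set. Those not worse than a fixed one lie in a box, and the bound attains its
  minimum on the resulting compact set.\<close>

lemma optimal_schedule_exists:
  fixes q rel :: "'a::finite \<Rightarrow> real"
  obtains s T where "schedule q rel s T" "\<And>s' T'. schedule q rel s' T' \<Longrightarrow> T \<le> T'"
proof -
  obtain s0 T0 where s0: "schedule q rel s0 T0" by (rule schedule_exists)
  define C where "C = {v :: (real^'a) \<times> real. schedule q rel (\<lambda>i. fst v $ i) (snd v)}"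
  have "closed C"
    unfolding C_def schedule_def
    by (intro closed_Collect_conj closed_Collect_all closed_Collect_le continuous_intros)
  define B where "B = cbox (0 :: real^'a, 0) (\<chi> i. T0, T0)"
  have B: "v \<in> B" if "v \<in> C" "snd v \<le> T0" for v
  proof -
    have *: "0 \<le> fst v $ i" "fst v $ i \<le> snd v" for i
      using that abs_ge_zero[of "q i"]
      by (auto simp: C_def schedule_def intro: order_trans[OF abs_ge_zero])
    then have "fst v $ i \<le> T0" for i using that(2) by (meson order_trans)
    with * that(2) show ?thesis
      by (cases v) (force simp: B_def cbox_Pair_eq mem_box_cart intro: order_trans)
  qed
  have "compact (B \<inter> C)"
    using \<open>closed C\<close> by (auto simp: B_def)
  moreover have v0: "(\<chi> i. s0 i, T0) \<in> B \<inter> C"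
    using s0 B[of "(\<chi> i. s0 i, T0)"] by (simp add: C_def vec_lambda_inverse)
  moreover have "continuous_on (B \<inter> C) snd"
    by (intro continuous_intros)
  ultimately obtain v where v: "v \<in> B \<inter> C" "\<And>w. w \<in> B \<inter> C \<Longrightarrow> snd v \<le> snd w"
    using continuous_attains_inf[of "B \<inter> C" snd] by blast
  show ?thesis
  proof
    show "schedule q rel (\<lambda>i. fst v $ i) (snd v)" using v(1) by (simp add: C_def)
    fix s' T' assume s': "schedule q rel s' T'"
    show "snd v \<le> T'"
    proof (cases "T' \<le> T0")
      case True
      then show ?thesis
        using v(2)[of "(\<chi> i. s' i, T')"] B[of "(\<chi> i. s' i, T')"] s'
        by (simp add: C_def vec_lambda_inverse)
    next
      case False
      then show ?thesis using v(2)[OF v0] by simp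
    qed
  qed
qed

section \<open>Optimal trajectories and the requests on which they finish\<close>

lemma opt_attained:
  fixes q rel :: "'a::finite \<Rightarrow> real"
  assumes "\<And>i. 0 \<le> rel i"
  obtains x T where "optimal q rel x" "opt q rel = ereal T"
proof -
  obtain s T where s: "schedule q rel s T" "\<And>s' T'. schedule q rel s' T' \<Longrightarrow> T \<le> T'"
    by (rule optimal_schedule_exists[of q rel]) blast
  obtain x where x: "trajectory x" "makespan q rel x \<le> ereal T"
    using schedule_imp_trajectory[OF s(1)] by metis
  have lower: "ereal T \<le> makespan q rel y" if "trajectory y" for y
  proof (cases "makespan q rel y = \<infinity>")
    case False
    then show ?thesis
      using trajectory_imp_schedule[of y rel q] that assms s(2) by (metis ereal_less_eq(3))
  qed simp
  have opt: "opt q rel = ereal T"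
    unfolding opt_def using x lower by (intro antisym INF_lower2[of x] INF_greatest) auto
  moreover have "optimal q rel x"
    unfolding optimal_def using x lower[OF x(1)] opt by auto
  ultimately show ?thesis using that by blast
qed

text \<open>Makes the minimum in \<open>final_error\<close> one over a nonempty set.\<close>

lemma opt_finals_nonempty:
  fixes q rel :: "'a::finite \<Rightarrow> real"
  assumes "\<And>i. 0 \<le> rel i"
  shows "opt_finals q rel \<noteq> {}"
proof -
  obtain x T where x: "optimal q rel x" "opt q rel = ereal T"
    using opt_attained[of rel q] assms by blast
  then have "trajectory x" "makespan q rel x \<noteq> \<infinity>" by (auto simp: optimal_def)
  then obtain s T' where s: "\<And>i. serve_time q rel x i = ereal (s i)" "T' \<in> range s"
      "makespan q rel x = ereal T'"
    using trajectory_imp_schedule[of x rel q] assms by metis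
  then show ?thesis using x(1) by (force simp: opt_finals_def)
qed

lemma opt_finals_schedule:
  fixes q rel :: "'a::finite \<Rightarrow> real"
  assumes "\<And>i. 0 \<le> rel i" "f \<in> opt_finals q rel"
  obtains s T where "opt q rel = ereal T" "schedule q rel s T" "s f = T"
proof -
  obtain x where x: "optimal q rel x" "serve_time q rel x f = makespan q rel x"
    using assms(2) by (auto simp: opt_finals_def)
  obtain T0 where "opt q rel = ereal T0"
    using opt_attained[of rel q] assms(1) by metis
  with x have "trajectory x" "makespan q rel x \<noteq> \<infinity>" by (auto simp: optimal_def)
  then obtain s T where "schedule q rel s T" "\<And>i. serve_time q rel x i = ereal (s i)"
      "makespan q rel x = ereal T"
    using trajectory_imp_schedule[of x rel q] assms(1) by metis
  moreover from this have "s f = T"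
    using x(2) by (metis ereal.inject)
  ultimately show ?thesis using x(1) that[of T s] by (simp add: optimal_def)
qed

section \<open>The sweep between two releases\<close>

lemma follow_two_right:
  assumes "w1 \<le> w2" "0 \<le> s"
  shows "follow y [w1, w2] s =
    (if s < \<bar>w1 - y\<bar> then y + sgn (w1 - y) * s else min (w1 + (s - \<bar>w1 - y\<bar>)) w2)"
  using assms by (auto simp: sgn_if min_def)

lemma follow_mirror: "follow (- y) (map uminus w) s = - follow y w s"
  by (induction w arbitrary: y s) (auto simp: sgn_if abs_minus_commute)

lemma follow_dist: "0 \<le> s \<Longrightarrow> \<bar>follow y w s - y\<bar> \<le> s"
proof (induction w arbitrary: y s)
  case (Cons a w)
  show ?case
  proof (cases "s < \<bar>a - y\<bar>")
    case False
    then have "\<bar>follow a w (s - \<bar>a - y\<bar>) - a\<bar> \<le> s - \<bar>a - y\<bar>"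
      by (intro Cons.IH) simp
    with False show ?thesis by simp
  qed (use Cons.prems in \<open>auto simp: sgn_if\<close>)
qed simp

lemma served_mono: "served q rel x i t \<Longrightarrow> t \<le> t' \<Longrightarrow> served q rel x i t'"
  unfolding served_def by force

lemma served_cong:
  assumes "\<And>s. s \<le> t \<Longrightarrow> x s = y s"
  shows "served q rel x i t \<longleftrightarrow> served q rel y i t"
  unfolding served_def using assms by metis

lemma served_mirror: "served (\<lambda>i. - q i) rel (\<lambda>t. - x t) i t \<longleftrightarrow> served q rel x i t"
  by (simp add: served_def)

text \<open>The invariant of the sweep that goes left first. Up to the prediction error, \<open>K\<close> is the
  optimum minus the position of the final request, and moving on from \<open>x t\<close> to the leftmost
  released unserved request and then to the right reaches any position \<open>b\<close> by time \<open>K + b\<close>.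
  The disjunct \<open>x t = - t\<close> covers the initial run to the left, during which unreleased predictions
  may still lie further left.\<close>

definition sweep_inv ::
  "('a \<Rightarrow> real) \<Rightarrow> ('a \<Rightarrow> real) \<Rightarrow> ('a \<Rightarrow> real) \<Rightarrow> real \<Rightarrow> real \<Rightarrow> (real \<Rightarrow> real) \<Rightarrow> bool" where
  "sweep_inv q rel p K t x \<longleftrightarrow>
     t - x t \<le> K \<and>
     (\<forall>i. rel i \<le> t \<longrightarrow> \<not> served q rel x i t \<longrightarrow> t + \<bar>x t - q i\<bar> - q i \<le> K) \<and>
     (x t = - t \<or> (\<forall>i. t < rel i \<longrightarrow> x t \<le> p i))"

lemma sweep_inv_cong:
  assumes "\<And>s. s \<le> t \<Longrightarrow> x s = y s"
  shows "sweep_inv q rel p K t x \<longleftrightarrow> sweep_inv q rel p K t y"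
proof -
  have "x t = y t" using assms by simp
  moreover have "served q rel x i t \<longleftrightarrow> served q rel y i t" for i
    using assms by (rule served_cong)
  ultimately show ?thesis by (simp add: sweep_inv_def)
qed

text \<open>At time \<open>v\<close> the agent is still on its way to the first waypoint, from the
  right or from the left, or has reached it. The hypotheses \<open>late\<close> ensure that
  \<open>K\<close> already pays for waiting until \<open>v\<close> and for going back to a request
  released at \<open>v\<close>.\<close>

lemma sweep_inv_step:
  fixes q rel p :: "'a::finite \<Rightarrow> real"
  defines "Out \<equiv> \<lambda>x t. q ` {i. rel i \<le> t \<and> \<not> served q rel x i t}"
    and "P' \<equiv> \<lambda>t. p ` {i. t < rel i}"
  assumes inv: "sweep_inv q rel p K u x"
    and "0 \<le> u" "u < v" "\<exists>i. rel i = v"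
    and gap: "\<And>i. u < rel i \<Longrightarrow> v \<le> rel i"
    and motion: "\<And>s. u \<le> s \<Longrightarrow> x s = follow (x u) [Min (P' u \<union> Out x u), Min (P' u)] (s - u)"
    and err: "\<And>i. \<bar>q i - p i\<bar> \<le> e"
    and late: "\<And>i. rel i - q i + e \<le> K" "\<And>i. - 2 * q i \<le> K"
  shows "sweep_inv q rel p K v x"
proof -
  define w1 where "w1 = Min (P' u \<union> Out x u)"
  define w2 where "w2 = Min (P' u)"
  have fin: "finite (P' u)" "finite (Out x u)" "P' u \<noteq> {}"
    using \<open>\<exists>i. rel i = v\<close> \<open>u < v\<close> by (auto simp: P'_def Out_def)
  have "w1 \<le> w2" unfolding w1_def w2_def using fin by (intro Min_antimono) auto
  have pos: "x s = (if s - u < \<bar>w1 - x u\<bar> then x u + sgn (w1 - x u) * (s - u)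
      else min (w1 + (s - u - \<bar>w1 - x u\<bar>)) w2)" if "u \<le> s" for s
    using motion[OF that] follow_two_right[OF \<open>w1 \<le> w2\<close>, of "s - u" "x u"] that
    by (simp add: w1_def w2_def)
  have w2_le: "w2 \<le> p i" if "u < rel i" for i
    unfolding w2_def using fin that by (intro Min_le) (auto simp: P'_def)
  have w1_le: "w1 \<le> q i" if "rel i \<le> u" "\<not> served q rel x i u" for i
    unfolding w1_def using fin that by (intro Min_le) (auto simp: Out_def)
  \<comment> \<open>Such a request is released at \<open>v\<close> or later, so being at or beyond
    its prediction at time \<open>v\<close> is early enough; \<open>e\<close> absorbs the gap
    between \<open>p i\<close> and \<open>q i\<close>.\<close>
  have bound_unreleased: "v - y \<le> K" if a: "a \<in> P' u" "a \<le> y" for a y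
  proof -
    obtain i where "u < rel i" "a = p i" using a(1) by (auto simp: P'_def)
    then show ?thesis using late(1)[of i] err[of i] gap[of i] a(2) by linarith
  qed
  have inv': "u - x u \<le> K"
    "\<And>i. rel i \<le> u \<Longrightarrow> \<not> served q rel x i u \<Longrightarrow> u + \<bar>x u - q i\<bar> - q i \<le> K"
    "x u = - u \<or> (\<forall>i. u < rel i \<longrightarrow> x u \<le> p i)"
    using inv by (auto simp: sweep_inv_def)
  \<comment> \<open>The disjunct ranges over all requests unreleased at \<open>u\<close>, hence also
    over those released at \<open>v\<close>, for which \<open>new\<close> needs it.\<close>
  have left: "x v = - v \<or> (\<forall>i. u < rel i \<longrightarrow> x v \<le> p i)" and lag: "v - x v \<le> K"
    and old: "\<And>i. rel i \<le> u \<Longrightarrow> \<not> served q rel x i v \<Longrightarrow> v + \<bar>x v - q i\<bar> - q i \<le> K"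
  proof -
    consider (left) "w1 < x u" "v - u < x u - w1" | (right) "x u < w1" "v - u < w1 - x u"
      | (arrived) "\<bar>w1 - x u\<bar> \<le> v - u"
      using \<open>u < v\<close> by (cases "\<bar>w1 - x u\<bar> \<le> v - u"; cases "w1 < x u") auto
    then have "(x v = - v \<or> (\<forall>i. u < rel i \<longrightarrow> x v \<le> p i)) \<and> v - x v \<le> K \<and>
        (\<forall>i. rel i \<le> u \<longrightarrow> \<not> served q rel x i v \<longrightarrow> v + \<bar>x v - q i\<bar> - q i \<le> K)"
    proof cases
      case left
      then have xv: "x v = x u - (v - u)" using pos[of v] \<open>u < v\<close> by simp
      have "w1 \<in> P' u \<union> Out x u" unfolding w1_def using fin by (intro Min_in) auto
      then have lag: "v - x v \<le> K"
      proof
        assume "w1 \<in> P' u"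
        then show ?thesis using bound_unreleased left xv by force
      next
        assume "w1 \<in> Out x u"
        then obtain i where "rel i \<le> u" "\<not> served q rel x i u" "w1 = q i"
          by (auto simp: Out_def)
        then show ?thesis using inv'(2)[of i] left xv by linarith
      qed
      have "v + \<bar>x v - q i\<bar> - q i \<le> K" if "rel i \<le> u" "\<not> served q rel x i v" for i
      proof -
        have "\<not> served q rel x i u"
          using that(2) served_mono[of q rel x i u v] \<open>u < v\<close> by force
        then show ?thesis using inv'(2)[of i] that(1) lag xv \<open>u < v\<close> by linarith
      qed
      \<comment> \<open>Moving left preserves either disjunct: a full-speed run from the origin
        continues, and predictions to the right stay to the right.\<close>
      moreover have "x v = - v \<or> (\<forall>i. u < rel i \<longrightarrow> x v \<le> p i)"
        using inv'(3) xv \<open>u < v\<close> by force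
      ultimately show ?thesis using lag by blast
    next
      case right
      \<comment> \<open>Moving right leaves \<open>t - x t\<close> unchanged. All outstanding
        requests lie at or beyond \<open>w1\<close>, so their terms in the invariant equal this
        lag.\<close>
      then have xv: "x v = x u + (v - u)" using pos[of v] \<open>u < v\<close> by simp
      have "v + \<bar>x v - q i\<bar> - q i \<le> K" if "rel i \<le> u" "\<not> served q rel x i v" for i
      proof -
        have "\<not> served q rel x i u"
          using that(2) served_mono[of q rel x i u v] \<open>u < v\<close> by force
        then show ?thesis using w1_le[of i] that(1) inv'(1) right xv by linarith
      qed
      moreover have "x v \<le> p i" if "u < rel i" for i
        using w2_le[OF that] \<open>w1 \<le> w2\<close> right xv by linarith
      ultimately show ?thesis using inv'(1) xv by auto
    next
      case arrived
      define D where "D = \<bar>w1 - x u\<bar>"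
      have xv: "x v = min (w1 + (v - u - D)) w2"
        using pos[of v] arrived \<open>u < v\<close> by (simp add: D_def)
      have "w2 \<in> P' u" unfolding w2_def using fin by (intro Min_in)
      have "w1 \<in> P' u \<union> Out x u" unfolding w1_def using fin by (intro Min_in) auto
      have lag_w1: "u + D - w1 \<le> K" if "w1 \<notin> P' u"
      proof -
        have "w1 \<in> Out x u" using \<open>w1 \<in> P' u \<union> Out x u\<close> that by blast
        then obtain i where "rel i \<le> u" "\<not> served q rel x i u" "w1 = q i"
          by (auto simp: Out_def)
        then show ?thesis using inv'(2)[of i] by (simp add: D_def abs_minus_commute)
      qed
      \<comment> \<open>At \<open>w2\<close> the bound comes from an unreleased request. Otherwise
        the agent has been moving right from \<open>w1\<close> since time \<open>u + D\<close>, with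
        the lag it had there.\<close>
      have lag: "v - x v \<le> K"
      proof (cases "x v = w2")
        case True
        then show ?thesis using bound_unreleased \<open>w2 \<in> P' u\<close> by blast
      next
        case False
        then have "x v = w1 + (v - u - D)" using xv by (auto simp: min_def split: if_splits)
        moreover have "u + D - w1 \<le> K"
        proof (cases "w1 \<in> P' u")
          case True
          then show ?thesis using bound_unreleased[of w1 w1] arrived by (simp add: D_def)
        qed (rule lag_w1)
        ultimately show ?thesis by linarith
      qed
      have "v + \<bar>x v - q i\<bar> - q i \<le> K" if "rel i \<le> u" "\<not> served q rel x i v" for i
      proof (cases "q i \<le> x v")
        case True
        have "\<not> served q rel x i u"
          using that(2) served_mono[of q rel x i u v] \<open>u < v\<close> by force
        then have "w1 \<le> q i" using w1_le that(1) by blast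
        \<comment> \<open>The time at which the agent passes \<open>q i\<close> after its arrival at
          \<open>w1\<close>; the cap \<open>w2\<close> is not yet in force, since
          \<open>q i \<le> x v\<close>.\<close>
        define s where "s = u + D + (q i - w1)"
        have "u \<le> s" "s \<le> v" using True xv \<open>w1 \<le> q i\<close> by (auto simp: s_def D_def)
        moreover have "x s = q i"
          using pos[OF \<open>u \<le> s\<close>] True xv \<open>w1 \<le> q i\<close> by (auto simp: s_def D_def)
        ultimately have "served q rel x i v"
          using that(1) unfolding served_def by (intro exI[of _ s]) auto
        with that(2) show ?thesis by blast
      qed (use lag in linarith)
      moreover have "x v \<le> p i" if "u < rel i" for i
        using w2_le[OF that] xv by linarith
      ultimately show ?thesis using lag by blast
    qed
    then show "x v = - v \<or> (\<forall>i. u < rel i \<longrightarrow> x v \<le> p i)" "v - x v \<le> K"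
      "\<And>i. rel i \<le> u \<Longrightarrow> \<not> served q rel x i v \<Longrightarrow> v + \<bar>x v - q i\<bar> - q i \<le> K"
      by blast+
  qed
  \<comment> \<open>A request to the right costs only the lag. For one to the left, the term is
    \<open>- 2 * q i\<close> during the initial run; afterwards \<open>x v \<le> p i\<close> limits
    the way back to \<open>e\<close>, and \<open>rel i - q i + e \<le> K\<close> pays for
    it.\<close>
  have new: "v + \<bar>x v - q i\<bar> - q i \<le> K" if "rel i = v" for i
    using left
  proof
    assume "x v = - v"
    then show ?thesis using late(2)[of i] lag by linarith
  next
    assume "\<forall>i. u < rel i \<longrightarrow> x v \<le> p i"
    then have "x v \<le> p i" using that \<open>u < v\<close> by simp
    then show ?thesis using lag late(1)[of i] err[of i] that by linarith
  qed
  have "v + \<bar>x v - q i\<bar> - q i \<le> K" if "rel i \<le> v" "\<not> served q rel x i v" for i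
    using old[of i] new[of i] gap[of i] that by fastforce
  then show ?thesis
    using left lag \<open>u < v\<close> by (auto simp: sweep_inv_def)
qed

section \<open>The run of PIVOT\<close>

lemma follow_0: "follow y w 0 = y"
  by (induction w arbitrary: y) auto

lemma pivot_update_before: "s \<le> t \<Longrightarrow> pivot_update q rel p f' t x s = x s"
  by (simp add: pivot_update_def Let_def)

lemma pivot_update_after:
  assumes "t \<le> s"
  shows "pivot_update q rel p f' t x s =
    follow (x t) (pivot_plan (range p) (p f') (x t)
      (q ` {i. rel i \<le> t \<and> \<not> served q rel x i t}) (p ` {i. t < rel i})) (s - t)"
proof (cases "s = t")
  case True
  then show ?thesis by (simp add: pivot_update_before follow_0)
next
  case False
  then show ?thesis using assms by (simp add: pivot_update_def Let_def)
qed

lemma served_pivot_update: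
  "served q rel (pivot_update q rel p f' t x) i t \<longleftrightarrow> served q rel x i t"
  by (intro served_cong pivot_update_before)

lemma sweep_inv_pivot_update_right:
  fixes q rel p :: "'a::finite \<Rightarrow> real"
  assumes "sweep_inv q rel p K u x" "0 \<le> u" "u < v" "\<exists>i. rel i = v"
    and gap: "\<And>i. u < rel i \<Longrightarrow> v \<le> rel i"
    and "\<And>i. \<bar>q i - p i\<bar> \<le> e" "\<And>i. rel i - q i + e \<le> K" "\<And>i. - 2 * q i \<le> K"
    and right: "(Max (range p) + Min (range p)) / 2 < p f'"
  shows "sweep_inv q rel p K v (pivot_update q rel p f' u x)" (is "sweep_inv q rel p K v ?y")
proof (rule sweep_inv_step)
  show "sweep_inv q rel p K u ?y"
    using assms(1) by (subst sweep_inv_cong[of u _ x]) (auto simp: pivot_update_before)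
  fix s assume "u \<le> s"
  define A where "A = p ` {i. u < rel i}"
  define B where "B = q ` {i. rel i \<le> u \<and> \<not> served q rel x i u}"
  have "A \<noteq> {}" using assms(3,4) by (auto simp: A_def)
  then have "pivot_plan (range p) (p f') (x u) B A = [Min (A \<union> B), Min A]"
    using right by (simp add: pivot_plan_def)
  then have "?y s = follow (x u) [Min (A \<union> B), Min A] (s - u)"
    unfolding pivot_update_after[OF \<open>u \<le> s\<close>] A_def[symmetric] B_def[symmetric] by simp
  then show "?y s = follow (?y u) [Min (p ` {i. u < rel i} \<union>
      q ` {i. rel i \<le> u \<and> \<not> served q rel ?y i u}), Min (p ` {i. u < rel i})] (s - u)"
    unfolding served_pivot_update A_def B_def by (simp only: pivot_update_before order_refl)
qed (fact assms)+

text \<open>Reflection in the origin turns the maxima of the plan into minima, so that the step for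
  the other direction applies to the negated data.\<close>

lemma sweep_inv_pivot_update_left:
  fixes q rel p :: "'a::finite \<Rightarrow> real"
  assumes "sweep_inv (\<lambda>i. - q i) rel (\<lambda>i. - p i) K u (\<lambda>t. - x t)"
    and "0 \<le> u" "u < v" "\<exists>i. rel i = v"
    and gap: "\<And>i. u < rel i \<Longrightarrow> v \<le> rel i"
    and err: "\<And>i. \<bar>q i - p i\<bar> \<le> e" and "\<And>i. rel i + q i + e \<le> K" "\<And>i. 2 * q i \<le> K"
    and left: "\<not> (Max (range p) + Min (range p)) / 2 < p f'"
  shows "sweep_inv (\<lambda>i. - q i) rel (\<lambda>i. - p i) K v (\<lambda>t. - pivot_update q rel p f' u x t)"
    (is "sweep_inv ?q rel ?p K v (\<lambda>t. - ?y t)")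
proof (rule sweep_inv_step)
  show "sweep_inv ?q rel ?p K u (\<lambda>t. - ?y t)"
    using assms(1) by (subst sweep_inv_cong[of u _ "\<lambda>t. - x t"]) (auto simp: pivot_update_before)
  fix s assume "u \<le> s"
  define A where "A = p ` {i. u < rel i}"
  define B where "B = q ` {i. rel i \<le> u \<and> \<not> served q rel x i u}"
  have fin: "finite A" "finite B" "A \<noteq> {}"
    using assms(3,4) by (auto simp: A_def B_def)
  have images: "?p ` {i. u < rel i} = uminus ` A"
    "?q ` {i. rel i \<le> u \<and> \<not> served q rel x i u} = uminus ` B"
    by (auto simp: A_def B_def image_image)
  have "pivot_plan (range p) (p f') (x u) B A = [Max (A \<union> B), Max A]"
    using left fin(3) by (simp add: pivot_plan_def)
  then have "- ?y s = follow (- x u) (map uminus [Max (A \<union> B), Max A]) (s - u)"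
    unfolding follow_mirror pivot_update_after[OF \<open>u \<le> s\<close>] A_def[symmetric] B_def[symmetric]
    by simp
  also have "map uminus [Max (A \<union> B), Max A] =
      [Min (uminus ` (A \<union> B)), Min (uminus ` A)]"
    using fin minus_Max_eq_Min[of "A \<union> B"] minus_Max_eq_Min[of A] by (simp del: minus_Max_eq_Min)
  finally show "- ?y s = follow (- ?y u) [Min (?p ` {i. u < rel i} \<union>
      ?q ` {i. rel i \<le> u \<and> \<not> served ?q rel (\<lambda>t. - ?y t) i u}),
      Min (?p ` {i. u < rel i})] (s - u)"
    unfolding served_mirror served_pivot_update images image_Un
    by (simp only: pivot_update_before order_refl)
next
  show "\<bar>?q i - ?p i\<bar> \<le> e" for i using err[of i] by (simp add: abs_minus_commute)
  show "rel i - ?q i + e \<le> K" "- 2 * ?q i \<le> K" for i using assms(7,8)[of i] by simp_all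
qed (fact assms)+

text \<open>\<open>I u x\<close> concerns the trajectory before the update at \<open>u\<close>. The
  last update is split off because its plan, with no predictions left, follows a different
  rule.\<close>

lemma fold_pivot_update_induct:
  fixes q rel p :: "'a::finite \<Rightarrow> real"
  assumes step: "\<And>u v x. 0 \<le> u \<Longrightarrow> u < v \<Longrightarrow> \<exists>i. rel i = v \<Longrightarrow> (\<And>i. u < rel i \<Longrightarrow> v \<le> rel i) \<Longrightarrow>
      I u x \<Longrightarrow> I v (pivot_update q rel p f' u x)"
    and "sorted_wrt (<) (u # ts)" "0 \<le> u" "set ts \<subseteq> range rel"
      "\<And>i. rel i \<le> u \<or> rel i \<in> set ts" "I u x"
  shows "\<exists>r x'. fold (pivot_update q rel p f') (u # ts) x = pivot_update q rel p f' r x' \<and> I r x' \<and>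
    (\<forall>i. rel i \<le> r) \<and> r \<in> insert u (range rel)"
  using assms(2-)
proof (induction ts arbitrary: u x)
  case Nil
  then show ?case by (intro exI[of _ u] exI[of _ x]) auto
next
  case (Cons v ts)
  have "u < v" using Cons.prems(1) by simp
  have "v \<in> range rel" using Cons.prems(3) by simp
  have "v \<le> rel i" if "u < rel i" for i
    using Cons.prems(4)[of i] Cons.prems(1) that by (auto intro: less_imp_le)
  with \<open>u < v\<close> \<open>v \<in> range rel\<close> Cons.prems have "I v (pivot_update q rel p f' u x)"
    by (intro step) auto
  moreover have "rel i \<le> v \<or> rel i \<in> set ts" for i
    using Cons.prems(4)[of i] \<open>u < v\<close> by auto
  ultimately have "\<exists>r x'. fold (pivot_update q rel p f') (v # ts) (pivot_update q rel p f' u x) =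
      pivot_update q rel p f' r x' \<and> I r x' \<and> (\<forall>i. rel i \<le> r) \<and> r \<in> insert v (range rel)"
    using Cons.prems \<open>u < v\<close> by (intro Cons.IH) auto
  then show ?case using \<open>v \<in> range rel\<close> by (auto simp: insert_absorb)
qed

lemma pivot_induct:
  fixes q rel p :: "'a::finite \<Rightarrow> real"
  assumes "\<And>i. 0 \<le> rel i" "I 0 (\<lambda>_. 0)"
    and "\<And>u v x. 0 \<le> u \<Longrightarrow> u < v \<Longrightarrow> \<exists>i. rel i = v \<Longrightarrow> (\<And>i. u < rel i \<Longrightarrow> v \<le> rel i) \<Longrightarrow>
      I u x \<Longrightarrow> I v (pivot_update q rel p f' u x)"
  obtains r x where "pivot q rel p f' = pivot_update q rel p f' r x" "I r x"
    "\<And>i. rel i \<le> r" "r \<in> insert 0 (range rel)"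
proof -
  define S where "S = insert 0 (range rel)"
  obtain u ts where list: "sorted_list_of_set S = u # ts"
    by (cases "sorted_list_of_set S") (auto simp: S_def)
  have sorted: "sorted_wrt (<) (u # ts)"
    using strict_sorted_list_of_set[of S] list by simp
  have "set (u # ts) = S"
    unfolding list[symmetric] by (intro set_sorted_list_of_set) (simp add: S_def)
  then have mem: "v = u \<or> v \<in> set ts \<longleftrightarrow> v = 0 \<or> v \<in> range rel" for v
    unfolding S_def by (metis insert_iff list.simps(15))
  have ts: "u < v" if "v \<in> set ts" for v
    using sorted that by simp
  \<comment> \<open>As no release is negative, the replanning times start with 0, where
    \<open>I\<close> is assumed for the constant trajectory.\<close>
  have "u \<le> 0"
    using mem[of 0] ts[of 0] by auto
  moreover have "0 \<le> u"
    using mem[of u] assms(1) by auto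
  ultimately have "u = 0" by simp
  have "set ts \<subseteq> range rel"
  proof
    fix v assume "v \<in> set ts"
    then show "v \<in> range rel" using mem[of v] ts[of v] \<open>u = 0\<close> by simp
  qed
  moreover have "rel i \<le> 0 \<or> rel i \<in> set ts" for i
    using mem[of "rel i"] \<open>u = 0\<close> by auto
  ultimately have "\<exists>r x'. fold (pivot_update q rel p f') (u # ts) (\<lambda>_. 0) =
      pivot_update q rel p f' r x' \<and> I r x' \<and> (\<forall>i. rel i \<le> r) \<and> r \<in> insert u (range rel)"
    using assms(2) \<open>u = 0\<close> sorted by (intro fold_pivot_update_induct assms(3)) auto
  then show ?thesis
    using that list \<open>u = 0\<close> by (auto simp: pivot_def S_def)
qed

text \<open>Comparing the position with the midpoint selects the nearer of the two extreme unserved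
  requests, and the sweep to the other one serves all the rest. The extremes are returned as
  requests \<open>i\<close> and \<open>j\<close> so that an invariant about unserved requests
  applies to them.\<close>

lemma makespan_last_update:
  fixes q rel p :: "'a::finite \<Rightarrow> real" and x :: "real \<Rightarrow> real" and f' :: 'a
  assumes "\<And>i. rel i \<le> r"
  defines "y \<equiv> pivot_update q rel p f' r x"
  shows "makespan q rel y \<le> ereal r \<or>
    (\<exists>i j. q i \<le> q j \<and> \<not> served q rel x i r \<and> \<not> served q rel x j r \<and>
      makespan q rel y \<le> ereal (r + min \<bar>x r - q i\<bar> \<bar>x r - q j\<bar> + (q j - q i)))"
proof (cases "\<forall>i. served q rel x i r")
  case True
  then have "\<forall>i. served q rel y i r"
    by (simp add: y_def served_pivot_update)
  then have "makespan q rel y \<le> ereal r"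
    unfolding makespan_def by (intro INF_lower) simp
  then show ?thesis ..
next
  case False
  define U where "U = {i. \<not> served q rel x i r}"
  have fin: "finite (q ` U)" "q ` U \<noteq> {}"
    using False by (auto simp: U_def)
  define a where "a = Min (q ` U)"
  define b where "b = Max (q ` U)"
  have "a \<in> q ` U" "b \<in> q ` U"
    unfolding a_def b_def using fin by (auto intro: Min_in Max_in)
  then obtain i j where ij: "a = q i" "b = q j" "i \<in> U" "j \<in> U"
    by blast
  have ab: "a \<le> q k" "q k \<le> b" if "k \<in> U" for k
    unfolding a_def b_def using that fin by auto
  then have "a \<le> b" using ij by force
  define t where "t = r + min \<bar>x r - a\<bar> \<bar>x r - b\<bar> + (b - a)"
  define w where "w = (if x r < (b + a) / 2 then [a, b] else [b, a])"
  have y: "y s = follow (x r) w (s - r)" if "r \<le> s" for s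
  proof -
    have "{i. rel i \<le> r \<and> \<not> served q rel x i r} = U" "{i. r < rel i} = {}"
      using assms(1) by (auto simp: U_def not_less)
    then show ?thesis
      using that fin(2) by (simp add: y_def pivot_update_after pivot_plan_def w_def a_def b_def)
  qed
  have "served q rel y k t" for k
  proof (cases "k \<in> U")
    case False
    then have "served q rel y k r"
      by (simp add: U_def y_def served_pivot_update)
    then show ?thesis
      by (rule served_mono) (use \<open>a \<le> b\<close> in \<open>simp add: t_def\<close>)
  next
    case True
    define s where "s = r + (if x r < (b + a) / 2 then \<bar>a - x r\<bar> + (q k - a)
      else \<bar>b - x r\<bar> + (b - q k))"
    have "r \<le> s" using ab[OF True] by (simp add: s_def)
    moreover have "y s = q k"
      using y[OF \<open>r \<le> s\<close>] ab[OF True] by (auto simp: w_def s_def abs_if)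
    moreover have "s \<le> t"
      using ab[OF True] by (auto simp: s_def t_def min_def abs_if field_simps)
    ultimately show ?thesis
      unfolding served_def using assms(1) order_trans by blast
  qed
  then have "makespan q rel y \<le> ereal t"
    unfolding makespan_def by (intro INF_lower) simp
  then show ?thesis
    using ij \<open>a \<le> b\<close> unfolding t_def U_def by blast
qed

section \<open>Makespan bounds for both sweep directions and the factor 3\<close>

lemma sweep_inv_start:
  assumes "\<And>i. 0 \<le> rel i" "0 \<le> K" "\<And>i. \<bar>q i\<bar> - q i \<le> K"
  shows "sweep_inv q rel p K 0 (\<lambda>_. 0)"
  using assms by (simp add: sweep_inv_def)

text \<open>The final plan is no longer than going to the left end \<open>i\<close> first and then
  to \<open>j\<close>, which by the invariant ends by \<open>K + q j\<close>. The bound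
  \<open>T \<le> M\<close> covers the case that nothing is left at the last release.\<close>

lemma pivot_right_makespan:
  fixes q rel p :: "'a::finite \<Rightarrow> real"
  assumes "\<And>i. 0 \<le> rel i" "0 \<le> K"
    and "\<And>i. \<bar>q i - p i\<bar> \<le> e" "\<And>i. rel i - q i + e \<le> K" "\<And>i. - 2 * q i \<le> K"
    and right: "(Max (range p) + Min (range p)) / 2 < p f'"
    and "\<And>i. rel i \<le> T" "0 \<le> T" "\<And>i. K + q i \<le> M" "T \<le> M"
  shows "makespan q rel (pivot q rel p f') \<le> ereal M"
proof -
  obtain r x where pivot: "pivot q rel p f' = pivot_update q rel p f' r x"
      and inv: "sweep_inv q rel p K r x" and r: "\<And>i. rel i \<le> r" "r \<in> insert 0 (range rel)"
  proof (rule pivot_induct[of rel "\<lambda>t x. sweep_inv q rel p K t x" q p f'])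
    show "sweep_inv q rel p K 0 (\<lambda>_. 0)"
      using assms(1,2,5) by (intro sweep_inv_start) (auto simp: abs_if)
  next
    fix u v x assume "0 \<le> u" "u < v" "\<exists>i. rel i = v" "\<And>i. u < rel i \<Longrightarrow> v \<le> rel i"
      "sweep_inv q rel p K u x"
    then show "sweep_inv q rel p K v (pivot_update q rel p f' u x)"
      using assms by (intro sweep_inv_pivot_update_right) auto
  qed (use assms(1) in auto)
  have "r \<le> T" using r(2) assms(7,8) by auto
  have "r + min \<bar>x r - q i\<bar> \<bar>x r - q j\<bar> + (q j - q i) \<le> M"
    if "\<not> served q rel x i r" for i j
  proof -
    have "r + \<bar>x r - q i\<bar> - q i \<le> K"
      using inv r(1)[of i] that by (auto simp: sweep_inv_def)
    then show ?thesis using assms(9)[of j] by linarith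
  qed
  then show ?thesis
    using makespan_last_update[of rel r q p f' x] r(1) \<open>r \<le> T\<close> assms(10)
    unfolding pivot by (meson ereal_less_eq(3) order_trans)
qed

text \<open>Only the invariant is reflected. The final plan treats a tie at the midpoint
  asymmetrically, but its bound with \<open>min\<close> is symmetric, so it is used in the original
  coordinates.\<close>

lemma pivot_left_makespan:
  fixes q rel p :: "'a::finite \<Rightarrow> real"
  assumes "\<And>i. 0 \<le> rel i" "0 \<le> K"
    and "\<And>i. \<bar>q i - p i\<bar> \<le> e" "\<And>i. rel i + q i + e \<le> K" "\<And>i. 2 * q i \<le> K"
    and left: "\<not> (Max (range p) + Min (range p)) / 2 < p f'"
    and "\<And>i. rel i \<le> T" "0 \<le> T" "\<And>i. K - q i \<le> M" "T \<le> M"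
  shows "makespan q rel (pivot q rel p f') \<le> ereal M"
proof -
  define I where "I = (\<lambda>t x. sweep_inv (\<lambda>i. - q i) rel (\<lambda>i. - p i) K t (\<lambda>t. - x t))"
  obtain r x where pivot: "pivot q rel p f' = pivot_update q rel p f' r x"
      and inv: "I r x" and r: "\<And>i. rel i \<le> r" "r \<in> insert 0 (range rel)"
  proof (rule pivot_induct[of rel I q p f'])
    show "I 0 (\<lambda>_. 0)"
      unfolding I_def minus_zero
    proof (rule sweep_inv_start)
      show "\<bar>- q i\<bar> - - q i \<le> K" for i using assms(2) assms(5)[of i] by linarith
    qed (use assms(1,2) in auto)
  next
    fix u v x assume "0 \<le> u" "u < v" "\<exists>i. rel i = v" "\<And>i. u < rel i \<Longrightarrow> v \<le> rel i" "I u x"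
    then show "I v (pivot_update q rel p f' u x)"
      using assms(3-6) unfolding I_def by (intro sweep_inv_pivot_update_left[where e = e]) auto
  qed (use assms(1) in auto)
  have "r \<le> T" using r(2) assms(7,8) by auto
  have "r + min \<bar>x r - q i\<bar> \<bar>x r - q j\<bar> + (q j - q i) \<le> M"
    if "\<not> served q rel x j r" for i j
  proof -
    have "r + \<bar>x r - q j\<bar> + q j \<le> K"
      using inv r(1)[of j] that unfolding I_def sweep_inv_def
      by (simp only: served_mirror) (simp add: abs_minus_commute)
    then show ?thesis using assms(9)[of i] by linarith
  qed
  then show ?thesis
    using makespan_last_update[of rel r q p f' x] r(1) \<open>r \<le> T\<close> assms(10)
    unfolding pivot by (meson ereal_less_eq(3) order_trans)
qed

lemma pivot_makespan_le_3:
  fixes q rel p s :: "'a::finite \<Rightarrow> real"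
  assumes "\<And>i. 0 \<le> rel i" "schedule q rel s T"
  shows "makespan q rel (pivot q rel p f') \<le> ereal (3 * T)"
proof -
  obtain r x where pivot: "pivot q rel p f' = pivot_update q rel p f' r x"
      and inv: "\<bar>x r\<bar> \<le> r" and r: "\<And>i. rel i \<le> r" "r \<in> insert 0 (range rel)"
  proof (rule pivot_induct[of rel "\<lambda>t x. \<bar>x t\<bar> \<le> t" q p f'])
    fix u v :: real and x :: "real \<Rightarrow> real" assume "u < v" "\<bar>x u\<bar> \<le> u"
    then have "\<bar>follow (x u) w (v - u)\<bar> \<le> v" for w
      using follow_dist[of "v - u" "x u" w] by linarith
    then show "\<bar>pivot_update q rel p f' u x v\<bar> \<le> v"
      unfolding pivot_update_after[OF less_imp_le[OF \<open>u < v\<close>]] .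
  qed (use assms(1) in auto)
  have sched: "rel i \<le> s i" "\<bar>q i\<bar> \<le> s i" "s i \<le> T" "\<bar>q i - q j\<bar> \<le> \<bar>s i - s j\<bar>" for i j
    using assms(2) by (auto simp: schedule_def)
  have "0 \<le> T"
    using sched[of undefined] by linarith
  have "rel i \<le> T" for i using sched(1,3)[of i] by linarith
  with \<open>0 \<le> T\<close> r(2) have "r \<le> T" by auto
  \<comment> \<open>A detour through the origin costs \<open>\<bar>x r\<bar> \<le> T\<close>. From
    there, visiting \<open>i\<close> and \<open>j\<close> in the order of the schedule costs at most
    \<open>T\<close>.\<close>
  have "r + min \<bar>x r - q i\<bar> \<bar>x r - q j\<bar> + (q j - q i) \<le> 3 * T" if "q i \<le> q j" for i j
    using that \<open>r \<le> T\<close> inv sched(2,3)[of i] sched(2,3)[of j] sched(4)[of i j] by linarith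
  moreover have "r \<le> 3 * T" using \<open>r \<le> T\<close> \<open>0 \<le> T\<close> by simp
  ultimately show ?thesis
    using makespan_last_update[of rel r q p f' x] r(1)
    unfolding pivot by (meson ereal_less_eq(3) order_trans)
qed

section \<open>The competitive ratio\<close>

text \<open>The denominator is twice the optimum in the worst case, the numerator twice the largest
  excess \<open>z + e\<close>. If \<open>z\<close> is within \<open>d + 2 * e\<close> of
  \<open>W / 2\<close>, both extremes are attained at once; for smaller \<open>z\<close> the excess
  shrinks faster than the bound \<open>W + z\<close> on the optimum allows.\<close>

lemma ratio_bound:
  fixes W d e z T A :: real
  assumes "0 < W" "0 \<le> d" "0 \<le> e" "0 \<le> z" "z \<le> W / 2 + d + 2 * e"
    and "A \<le> T + z + e" "W + min z (W - z) \<le> T" "0 < 3 * W - 2 * d - 4 * e"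
  shows "A \<le> (1 + (W + 2 * d + 6 * e) / (3 * W - 2 * d - 4 * e)) * T"
proof -
  define c where "c = 3 * W - 2 * d - 4 * e"
  have "(z + e) * c \<le> (W + 2 * d + 6 * e) * T"
  proof (cases "z \<le> W / 2 - d - 2 * e")
    case True
    then have "W + z \<le> T" using assms by (simp add: min_def split: if_splits)
    \<comment> \<open>The claim at the least possible optimum \<open>W + z\<close>, arranged as a
      sum of nonnegative products; the first one uses \<open>z \<le> W / 2\<close>.\<close>
    have "0 \<le> W * (W - 2 * z) + W * (2 * d + 3 * e) + 2 * (d + 2 * e) * (2 * z + e) + 2 * e * z"
      using True assms by (intro add_nonneg_nonneg mult_nonneg_nonneg) auto
    also have "\<dots> = (W + 2 * d + 6 * e) * (W + z) - (z + e) * c"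
      by (simp add: c_def algebra_simps)
    finally have "(z + e) * c \<le> (W + 2 * d + 6 * e) * (W + z)" by simp
    also have "\<dots> \<le> (W + 2 * d + 6 * e) * T"
      using \<open>W + z \<le> T\<close> assms by (intro mult_left_mono) auto
    finally show ?thesis .
  next
    case False
    then have "c \<le> 2 * T" using assms by (simp add: c_def min_def split: if_splits)
    moreover have "2 * (z + e) \<le> W + 2 * d + 6 * e" using assms by simp
    ultimately have "(2 * (z + e)) * c \<le> (W + 2 * d + 6 * e) * (2 * T)"
      using assms by (intro mult_mono) (auto simp: c_def)
    then show ?thesis by (simp add: algebra_simps)
  qed
  then have "z + e \<le> (W + 2 * d + 6 * e) / c * T"
    using assms(8) by (simp add: c_def pos_le_divide_eq)
  then show ?thesis using assms(6) by (simp add: c_def distrib_right)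
qed

lemma spread_eq:
  fixes q :: "'a::finite \<Rightarrow> real"
  assumes "q i = 0"
  shows "spread q = Max (range q) - Min (range q)"
proof -
  have "0 \<in> range q" using assms by (metis rangeI)
  then have "Min (range q) \<le> 0" "0 \<le> Max (range q)" by auto
  then show ?thesis by (simp add: spread_def)
qed

text \<open>\<open>z\<close> is the distance from \<open>q f\<close> to the end of the line towards
  which PIVOT sweeps last.\<close>

lemma pivot_makespan_le_additive:
  fixes q rel p s :: "'a::finite \<Rightarrow> real"
  assumes rel: "\<And>i. 0 \<le> rel i" and origin: "\<exists>i. q i = 0"
    and "schedule q rel s T" "s f = T"
    and err: "\<And>i. \<bar>q i - p i\<bar> \<le> e"
  obtains z where "0 \<le> z" "z \<le> spread q / 2 + \<bar>q f' - q f\<bar> + 2 * e"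
    "spread q + min z (spread q - z) \<le> T"
    "makespan q rel (pivot q rel p f') \<le> ereal (T + z + e)"
proof -
  define L where "L = Min (range q)"
  define R where "R = Max (range q)"
  have LR: "L \<le> q i" "q i \<le> R" for i by (auto simp: L_def R_def)
  have "L \<in> range q" "R \<in> range q" unfolding L_def R_def by (auto intro: Min_in Max_in)
  then obtain l r where lr: "q l = L" "q r = R" by auto
  have spread: "spread q = R - L"
    using spread_eq origin unfolding L_def R_def by blast
  have "0 \<le> e" using err[of f] by linarith
  have sched: "rel i \<le> s i" "\<bar>q i\<bar> \<le> s i" "s i \<le> T" "\<bar>q i - q j\<bar> \<le> \<bar>s i - s j\<bar>" for i j
    using assms(3) by (auto simp: schedule_def)
  have last: "s i + \<bar>q i - q f\<bar> \<le> T" for i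
    using sched(4)[of i f] sched(3)[of i] \<open>s f = T\<close> by simp
  have late: "rel i + \<bar>q i - q f\<bar> \<le> T" "\<bar>q i\<bar> + \<bar>q i - q f\<bar> \<le> T" for i
    using last[of i] sched(1,2)[of i] by linarith+
  have T: "0 \<le> T" "\<bar>q f\<bar> \<le> T" "rel i \<le> T" for i
    using late(2)[of f] late(1)[of i] by linarith+
  \<comment> \<open>Between the two extremes the schedule needs \<open>R - L\<close>, and from the
    later one it still has to get to \<open>q f\<close>.\<close>
  have opt: "(R - L) + min (R - q f) (q f - L) \<le> T"
    using last[of l] last[of r] sched(4)[of l r] sched(2)[of l] sched(2)[of r] lr LR[of f]
    by linarith
  have p: "L - e \<le> p i" "p i \<le> R + e" for i
    using LR[of i] err[of i] by linarith+
  have "Min (range p) \<le> p l" "p r \<le> Max (range p)" by simp_all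
  then have "Min (range p) \<le> L + e" "R - e \<le> Max (range p)"
    using err[of l] err[of r] lr by linarith+
  moreover have "L - e \<le> Min (range p)" "Max (range p) \<le> R + e"
    using p by auto
  ultimately have mid: "\<bar>Min (range p) - L\<bar> \<le> e" "\<bar>Max (range p) - R\<bar> \<le> e"
    by linarith+
  \<comment> \<open>One \<open>e\<close> is lost here and another one in the predicted midpoint,
    which gives the \<open>2 * e\<close> in the bound on \<open>z\<close>.\<close>
  have p_f': "\<bar>p f' - q f\<bar> \<le> \<bar>q f' - q f\<bar> + e"
    using err[of f'] by linarith
  have centre: "\<bar>(Max (range p) + Min (range p)) / 2 - (R + L) / 2\<bar> \<le> e"
    using mid unfolding abs_le_iff by (simp add: field_simps del: Max_le_iff Min_ge_iff)
  show ?thesis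
  proof (cases "(Max (range p) + Min (range p)) / 2 < p f'")
    case True
    \<comment> \<open>With this \<open>K\<close> the conditions of the sweep become
      \<open>late\<close>: after its release or after the way from the origin to \<open>q i\<close>,
      the optimum still has to go on to \<open>q f\<close>.\<close>
    have "makespan q rel (pivot q rel p f') \<le> ereal (T + (R - q f) + e)"
    proof (rule pivot_right_makespan[where K = "T - q f + e" and e = e and T = T])
      show "rel i - q i + e \<le> T - q f + e" "- 2 * q i \<le> T - q f + e" for i
        using late[of i] \<open>0 \<le> e\<close> by linarith+
      show "T - q f + e + q i \<le> T + (R - q f) + e" for i using LR(2)[of i] by simp
      show "T \<le> T + (R - q f) + e" using LR(2)[of f] \<open>0 \<le> e\<close> by simp
      show "0 \<le> T - q f + e" using T(2) \<open>0 \<le> e\<close> by simp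
    qed (fact rel err T True)+
    moreover have "R - q f \<le> (R - L) / 2 + \<bar>q f' - q f\<bar> + 2 * e"
      using True p_f' centre by argo
    ultimately show ?thesis
      using that[of "R - q f"] LR(2)[of f] opt by (simp add: spread)
  next
    case False
    have "makespan q rel (pivot q rel p f') \<le> ereal (T + (q f - L) + e)"
    proof (rule pivot_left_makespan[where K = "T + q f + e" and e = e and T = T])
      show "rel i + q i + e \<le> T + q f + e" "2 * q i \<le> T + q f + e" for i
        using late[of i] \<open>0 \<le> e\<close> by linarith+
      show "T + q f + e - q i \<le> T + (q f - L) + e" for i using LR(1)[of i] by simp
      show "T \<le> T + (q f - L) + e" using LR(1)[of f] \<open>0 \<le> e\<close> by simp
      show "0 \<le> T + q f + e" using T(2) \<open>0 \<le> e\<close> by simp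
    qed (fact rel err T False)+
    moreover have "q f - L \<le> (R - L) / 2 + \<bar>q f' - q f\<bar> + 2 * e"
      using False p_f' centre by argo
    ultimately show ?thesis
      using that[of "q f - L"] LR(1)[of f] opt by (simp add: spread min.commute)
  qed
qed

section \<open>From additive to normalised errors\<close>

lemma f_bound_ereal:
  "f_bound (ereal \<eta>) (ereal \<delta>) =
    (if 0 < 3 - 2 * (\<delta> + 2 * \<eta>)
     then ereal (1 + (1 + 2 * (\<delta> + 3 * \<eta>)) / (3 - 2 * (\<delta> + 2 * \<eta>))) else 3)"
proof -
  have "3 - 2 * (ereal \<delta> + 2 * ereal \<eta>) = ereal (3 - 2 * (\<delta> + 2 * \<eta>))"
    "1 + 2 * (ereal \<delta> + 3 * ereal \<eta>) = ereal (1 + 2 * (\<delta> + 3 * \<eta>))"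
    by (simp_all only: numeral_eq_ereal one_ereal_def times_ereal.simps plus_ereal.simps
        ereal_minus)
  then show ?thesis
    by (simp add: f_bound_def one_ereal_def)
qed

theorem theorem5:
  fixes q rel p :: "'a::finite \<Rightarrow> real" and f' :: 'a
  assumes "\<And>i. 0 \<le> rel i"
    and "\<exists>i. q i = 0 \<and> rel i = 0 \<and> p i = 0"
  shows "makespan q rel (pivot q rel p f')
           \<le> min (f_bound (loc_error q p) (final_error q rel f')) 3 * opt q rel"
proof -
  define W where "W = spread q"
  define e where "e = Max (range (\<lambda>i. \<bar>q i - p i\<bar>))"
  define D where "D = (\<lambda>f. \<bar>q f' - q f\<bar>) ` opt_finals q rel"
  \<comment> \<open>The optimum used for comparison ends on a request that attains the minimum in
    \<open>final_error\<close>.\<close>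
  have "finite D" "D \<noteq> {}"
    using opt_finals_nonempty[of rel q] assms(1) by (auto simp: D_def)
  then have "Min D \<in> D" by (rule Min_in)
  then obtain f where f: "f \<in> opt_finals q rel" "Min D = \<bar>q f' - q f\<bar>"
    by (auto simp: D_def)
  define d where "d = \<bar>q f' - q f\<bar>"
  have err: "\<bar>q i - p i\<bar> \<le> e" for i by (simp add: e_def)
  have "0 \<le> e" using err[of f] by linarith
  obtain s T where opt: "opt q rel = ereal T" and s: "schedule q rel s T" "s f = T"
    using opt_finals_schedule[of rel f q] assms(1) f(1) by metis
  have "\<exists>i. q i = 0" using assms(2) by blast
  then obtain z where z: "0 \<le> z" "z \<le> W / 2 + d + 2 * e" "W + min z (W - z) \<le> T"
      "makespan q rel (pivot q rel p f') \<le> ereal (T + z + e)"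
    using pivot_makespan_le_additive[of rel q s T f p e f'] assms(1) s err
    unfolding W_def d_def by metis
  have three: "makespan q rel (pivot q rel p f') \<le> 3 * ereal T"
    using pivot_makespan_le_3[of rel q s T p f'] assms(1) s(1) by simp
  have errors: "loc_error q p = ereal e / ereal W" "final_error q rel f' = ereal d / ereal W"
    using f(2) by (simp_all add: loc_error_def final_error_def e_def W_def d_def D_def)
  have "0 \<le> W" by (simp add: W_def spread_def)
  have "makespan q rel (pivot q rel p f') \<le>
      f_bound (loc_error q p) (final_error q rel f') * ereal T"
  proof (cases "W = 0")
    case False
    with \<open>0 \<le> W\<close> have "0 < W" by simp
    have f_bound: "f_bound (loc_error q p) (final_error q rel f') =
        (if 0 < 3 * W - 2 * d - 4 * e
         then ereal (1 + (W + 2 * d + 6 * e) / (3 * W - 2 * d - 4 * e)) else 3)"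
    proof -
      have "3 - 2 * (d / W + 2 * (e / W)) = (3 * W - 2 * d - 4 * e) / W"
        "1 + 2 * (d / W + 3 * (e / W)) = (W + 2 * d + 6 * e) / W"
        using \<open>0 < W\<close> by (simp_all add: field_simps)
      then show ?thesis
        using \<open>0 < W\<close> by (simp add: errors f_bound_ereal zero_less_divide_iff)
    qed
    show ?thesis
    proof (cases "0 < 3 * W - 2 * d - 4 * e")
      case True
      then have "T + z + e \<le> (1 + (W + 2 * d + 6 * e) / (3 * W - 2 * d - 4 * e)) * T"
        using \<open>0 < W\<close> \<open>0 \<le> e\<close> z by (intro ratio_bound[of W d e z]) (auto simp: d_def)
      then show ?thesis
        using z(4) True unfolding f_bound by (simp add: order_trans)
    qed (use three f_bound in simp)
  next
    case True
    \<comment> \<open>With all requests at the origin, exact predictions give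
      \<open>0 / 0 = 0\<close> for both errors and the ratio \<open>4 / 3\<close>, while
      \<open>z = 0\<close>. Any misprediction makes \<open>loc_error\<close> infinite, so that
      \<open>f_bound\<close> takes the value 3.\<close>
    have "q i = 0" for i
    proof -
      have "Min (range q) = 0" "Max (range q) = 0"
        using True by (simp_all add: W_def spread_def)
      then show ?thesis
        using Min_le[of "range q" "q i"] Max_ge[of "range q" "q i"] by simp
    qed
    then have "d = 0" by (simp add: d_def)
    show ?thesis
    proof (cases "e = 0")
      case True
      have "f_bound (loc_error q p) (final_error q rel f') = ereal (4 / 3)"
        using f_bound_ereal[of 0 0] by (simp add: errors \<open>W = 0\<close> \<open>d = 0\<close> True zero_ereal_def)
      moreover have "T \<le> 4 / 3 * T" "z = 0"
        using z(1-3) \<open>W = 0\<close> \<open>d = 0\<close> True by auto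
      ultimately show ?thesis
        using z(4) True by (simp add: order_trans)
    next
      case False
      then have "loc_error q p = \<infinity>" "final_error q rel f' = 0"
        using \<open>0 \<le> e\<close> by (simp_all add: errors \<open>W = 0\<close> \<open>d = 0\<close>)
      then show ?thesis using three by (simp add: f_bound_def)
    qed
  qed
  with three show ?thesis by (simp add: opt min_def)
qed

end
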